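(* Let $X$ be a connected trivalent vertex-transitive graph of order $2n$ admitting an $\mathrm{Aut}(X)$-invariant partition of $E(X)$ into a $1$-factor and a $2$-factor $F$, where $F$ consists of two $n$-cycles $C_1$ and $C_2$. Let $U=V(C_1)$ and let $H$ be the group of permutations of $U$ obtained by restricting to $U$ the elements of the setwise stabilizer $\mathrm{Aut}(X)_{\{U\}}$. If $H$ contains an $n$-cycle, then $X$ is isomorphic to a generalized Petersen graph $\mathrm{GP}(n,k)$ for some $k$.
   Context: A partition of $E(X)$ into factors is $\mathrm{Aut}(X)$-invariant if every automorphism of $X$ maps each factor onto itself. The generalized Petersen graph $\mathrm{GP}(n,k)$ has vertices $u_0,\dots,u_{n-1},v_0,\dots,v_{n-1}$ and edges $[u_i,u_{i+1}]$, $[u_i,v_i]$, $[v_i,v_{i+k}]$ for all $i$, subscripts modulo $n$. *)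

theory Defs
  imports "HOL-Combinatorics.Combinatorics" "HOL-Library.Disjoint_Sets"
begin

record 'a ugraph =
  verts :: "'a set"
  edges :: "'a set set"

definition simple_graph :: "'a ugraph \<Rightarrow> bool" where
  "simple_graph X \<longleftrightarrow>
     finite (verts X) \<and> (\<forall>e\<in>edges X. e \<subseteq> verts X \<and> card e = 2)"

definition connected_graph :: "'a ugraph \<Rightarrow> bool" where
  "connected_graph X \<longleftrightarrow> verts X \<noteq> {} \<and>
     (\<forall>x\<in>verts X. \<forall>y\<in>verts X. (x, y) \<in> {(a, b). {a, b} \<in> edges X}\<^sup>*)"

text \<open>A \<open>k\<close>-factor is a spanning \<open>k\<close>-regular subgraph, identified with its edge set.\<close>

definition k_factor :: "'a ugraph \<Rightarrow> nat \<Rightarrow> 'a set set \<Rightarrow> bool" where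
  "k_factor X k M \<longleftrightarrow>
     M \<subseteq> edges X \<and> (\<forall>v\<in>verts X. card {e \<in> M. v \<in> e} = k)"

definition trivalent :: "'a ugraph \<Rightarrow> bool" where
  "trivalent X \<longleftrightarrow> (\<forall>v\<in>verts X. card {e \<in> edges X. v \<in> e} = 3)"

definition isomorphic :: "'a ugraph \<Rightarrow> 'b ugraph \<Rightarrow> bool" where
  "isomorphic X Y \<longleftrightarrow>
     (\<exists>f. bij_betw f (verts X) (verts Y) \<and> (\<lambda>e. f ` e) ` edges X = edges Y)"

text \<open>Permutations of a set are represented, as in \<^const>\<open>permutes\<close>, by functions on the
  whole type that fix every element outside the set.\<close>

definition Aut :: "'a ugraph \<Rightarrow> ('a \<Rightarrow> 'a) set" where
  "Aut X = {g. g permutes verts X \<and> (\<lambda>e. g ` e) ` edges X = edges X}"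

definition vertex_transitive :: "'a ugraph \<Rightarrow> bool" where
  "vertex_transitive X \<longleftrightarrow> (\<forall>x\<in>verts X. \<forall>y\<in>verts X. \<exists>g\<in>Aut X. g x = y)"

definition setwise_stabilizer :: "'a ugraph \<Rightarrow> 'a set \<Rightarrow> ('a \<Rightarrow> 'a) set" where
  "setwise_stabilizer X U = {g \<in> Aut X. g ` U = U}"

definition Aut_invariant_partition :: "'a ugraph \<Rightarrow> 'a set set set \<Rightarrow> bool" where
  "Aut_invariant_partition X P \<longleftrightarrow>
     partition_on (edges X) P \<and> (\<forall>g\<in>Aut X. \<forall>A\<in>P. (\<lambda>e. g ` e) ` A = A)"

definition cycle_graph :: "nat \<Rightarrow> 'a ugraph \<Rightarrow> bool" where
  "cycle_graph n C \<longleftrightarrow> n \<ge> 3 \<and>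
     (\<exists>c. bij_betw c {..<n} (verts C) \<and>
          edges C = {{c i, c ((i + 1) mod n)} | i. i < n})"

definition cycle_permutation :: "nat \<Rightarrow> ('a \<Rightarrow> 'a) \<Rightarrow> bool" where
  "cycle_permutation n h \<longleftrightarrow>
     (\<exists>cs. distinct cs \<and> length cs = n \<and> h = cycle_of_list cs)"

datatype gp_vertex = u nat | v nat

text \<open>For degenerate \<open>k\<close> (with \<open>n\<close> dividing \<open>2 * k\<close>) this is not a trivalent simple graph:
  the edges joining the \<open>v i\<close> then collapse to singletons or coincide in pairs.\<close>

definition GP :: "nat \<Rightarrow> nat \<Rightarrow> gp_vertex ugraph" where
  "GP n k =
     \<lparr> verts = u ` {..<n} \<union> v ` {..<n},
       edges = {{u i, u ((i + 1) mod n)} | i. i < n}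
             \<union> {{u i, v i} | i. i < n}
             \<union> {{v i, v ((i + k) mod n)} | i. i < n} \<rparr>"

hide_const (open) u v

end

theory Submission
  imports Defs
begin

text \<open>
  The \<open>n\<close>-cycle in \<open>H\<close> lets us label \<open>U\<close> as an orbit \<open>w i\<close> of an automorphism \<open>g\<close>. The
  neighbours of \<open>w 0\<close> on \<open>C1\<close> must then be \<open>w a\<close> and \<open>w (- a)\<close>, so \<open>\<rho> = g ^ a\<close> moves every
  vertex of \<open>C1\<close> to a neighbour, and connectedness of \<open>C1\<close> makes \<open>U\<close> a single
  \<open>\<rho>\<close>-orbit \<open>p i\<close>. As \<open>\<rho>\<close> preserves the matching \<open>M\<close> and \<open>X\<close> is connected, every
  \<open>p i\<close> is matched to a vertex \<open>q i\<close> of \<open>C2\<close>, and \<open>\<rho>\<close> shifts the \<open>q i\<close> as well. The orbit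
  argument applied to \<open>C2\<close> gives the edges \<open>[q i, q (i + k)]\<close>.
\<close>

text \<open>\<open>f\<close> is injective only on \<open>verts X\<close>, so its inverse undoes it
  only on edges lying inside that set; this is what the second assumption provides.\<close>

lemma isomorphic_sym:
  assumes "isomorphic X Y" and "\<And>e. e \<in> edges X \<Longrightarrow> e \<subseteq> verts X"
  shows "isomorphic Y X"
proof -
  obtain f where f: "bij_betw f (verts X) (verts Y)" "(\<lambda>e. f ` e) ` edges X = edges Y"
    using assms(1) unfolding isomorphic_def by blast
  let ?g = "inv_into (verts X) f"
  have "?g ` f ` e = e" if "e \<in> edges X" for e
    using assms(2)[OF that] f(1) by (simp add: bij_betw_def inv_into_image_cancel)
  then have "(\<lambda>e. ?g ` e) ` edges Y = edges X"
    unfolding f(2)[symmetric] image_image by simp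
  then show ?thesis
    unfolding isomorphic_def using bij_betw_inv_into[OF f(1)] by blast
qed

lemma cycle_graph_edges_subset:
  assumes "cycle_graph n C" "e \<in> edges C"
  shows "e \<subseteq> verts C" "card e = 2"
proof -
  obtain c where n: "n \<ge> 3" and c: "bij_betw c {..<n} (verts C)"
    and E: "edges C = {{c i, c ((i + 1) mod n)} | i. i < n}"
    using assms(1) unfolding cycle_graph_def by blast
  obtain i where i: "i < n" "e = {c i, c ((i + 1) mod n)}"
    using assms(2) E by blast
  have j: "(i + 1) mod n < n" "(i + 1) mod n \<noteq> i"
    using n i(1) by (auto simp: mod_if)
  show "e \<subseteq> verts C"
    using c i j by (auto simp: bij_betw_def)
  have "c i \<noteq> c ((i + 1) mod n)"
    using c i(1) j unfolding bij_betw_def by (metis inj_onD lessThan_iff)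
  then show "card e = 2" using i(2) by simp
qed

lemma cycle_graph_card:
  assumes "cycle_graph n C"
  shows "card (verts C) = n" "finite (verts C)"
  using assms bij_betw_same_card bij_betw_finite unfolding cycle_graph_def
  by (metis card_lessThan, metis finite_lessThan)

text \<open>Walking round the cycle from \<open>x\<close> never leaves \<open>S\<close> and meets
  every vertex. This serves to show that an orbit exhausts its cycle.\<close>

lemma cycle_graph_closed_subset:
  assumes "cycle_graph n C" "x \<in> verts C" "x \<in> S"
    and closed: "\<And>y z. {y, z} \<in> edges C \<Longrightarrow> y \<in> S \<Longrightarrow> z \<in> S"
  shows "verts C \<subseteq> S"
proof -
  obtain c where n: "n \<ge> 3" and c: "bij_betw c {..<n} (verts C)"
    and E: "edges C = {{c i, c ((i + 1) mod n)} | i. i < n}"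
    using assms(1) unfolding cycle_graph_def by blast
  obtain i where i: "i < n" "x = c i"
    using assms(2) c unfolding bij_betw_def by auto
  have step: "c ((i + k) mod n) \<in> S" for k
  proof (induction k)
    case 0
    then show ?case using assms(3) i by simp
  next
    case (Suc k)
    have "{c ((i + k) mod n), c (((i + k) mod n + 1) mod n)} \<in> edges C"
      unfolding E using n by force
    from closed[OF this Suc.IH] show ?case by (simp add: mod_Suc_eq)
  qed
  have "c j \<in> S" if "j < n" for j
  proof -
    \<comment> \<open>Going forward \<open>n - i + j\<close> steps leads from \<open>i\<close> to
      \<open>j\<close> whichever is larger.\<close>
    have "(i + (n - i + j)) mod n = j" using i that by simp
    then show ?thesis using step by metis
  qed
  then have "c ` {..<n} \<subseteq> S" by auto
  then show ?thesis using bij_betw_imp_surj_on[OF c] by simp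
qed

text \<open>On natural numbers \<open>n - i\<close> stands for the negative of \<open>i\<close>
  modulo \<open>n\<close>, so adding \<open>i\<close> to both sides cancels it.\<close>

lemma mod_shift_eq_iff:
  fixes n i j d :: nat
  assumes "i < n"
  shows "(n - i + j) mod n = d mod n \<longleftrightarrow> j mod n = (i + d) mod n"
proof -
  have l: "(i + (n - i + j)) mod n = j mod n" and r: "(n - i + (i + d)) mod n = d mod n"
    using assms by (simp_all add: mod_add_left_eq)
  show ?thesis
    using mod_add_right_eq[of i "n - i + j" n] mod_add_right_eq[of i d n]
      mod_add_right_eq[of "n - i" j n] mod_add_right_eq[of "n - i" "i + d" n] l r
    by metis
qed

text \<open>A 2-regular graph on a cyclic orbit is a circulant with connection set \<open>{a, - a}\<close>: the
  connection set is closed under negation, and if one of its two elements were its own negative,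
  both would equal \<open>n / 2\<close>.\<close>

lemma orbit_edges_circulant:
  fixes w :: "nat \<Rightarrow> 'a"
  assumes n: "n > 0"
    and w: "\<And>i j. w i = w j \<longleftrightarrow> i mod n = j mod n"
    and s: "\<And>i. \<sigma> (w i) = w (Suc i)"
    and E: "\<And>e. e \<in> E \<Longrightarrow> e \<subseteq> range w \<and> card e = 2"
    and inv: "\<And>e. e \<in> E \<Longrightarrow> \<sigma> ` e \<in> E"
    and deg: "card {e \<in> E. w 0 \<in> e} = 2"
  shows "\<exists>k. E = {{w i, w (i + k)} | i. i < n}"
proof -
  have shift: "{w (i + d), w (j + d)} \<in> E" if "{w i, w j} \<in> E" for i j d
  proof (induction d)
    case 0
    then show ?case using that by simp
  next
    case (Suc d)
    then show ?case using inv[of "{w (i + d), w (j + d)}"] by (simp add: s)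
  qed
  have wm: "w (i mod n) = w i" for i by (simp add: w)
  have edge0: "\<exists>a. a < n \<and> a \<noteq> 0 \<and> e = {w 0, w a}" if e: "e \<in> E" "w 0 \<in> e" for e
  proof -
    obtain y where y: "e = {w 0, y}" "y \<noteq> w 0"
      using E[OF e(1)] e(2) by (auto simp: card_2_iff)
    obtain j where j: "y = w j" using E[OF e(1)] y by auto
    have "j mod n \<noteq> 0" using y j w[of j 0] by simp
    then show ?thesis using y j n wm[of j] by (intro exI[of _ "j mod n"]) auto
  qed
  obtain e1 e2 where e12: "{e \<in> E. w 0 \<in> e} = {e1, e2}" "e1 \<noteq> e2"
    using deg by (auto simp: card_2_iff)
  then have e12_in: "e1 \<in> E" "w 0 \<in> e1" "e2 \<in> E" "w 0 \<in> e2" by blast+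
  \<comment> \<open>\<open>a\<close> and \<open>b\<close> are the nonzero residues labelling the two
    neighbours of \<open>w 0\<close>.\<close>
  obtain a where a: "a < n" "a \<noteq> 0" "e1 = {w 0, w a}" using edge0[of e1] e12_in by blast
  obtain b where b: "b < n" "b \<noteq> 0" "e2 = {w 0, w b}" using edge0[of e2] e12_in by blast
  have ab: "a \<noteq> b" using a b e12 by auto
  have nbr: "j mod n = a \<or> j mod n = b" if "{w 0, w j} \<in> E" for j
  proof -
    have "{w 0, w j} \<in> {e \<in> E. w 0 \<in> e}" using that by simp
    then have "{w 0, w j} = e1 \<or> {w 0, w j} = e2" unfolding e12(1) by simp
    then have "w j = w a \<or> w j = w b \<or> w j = w 0"
      using a b by (auto simp: doubleton_eq_iff)
    moreover have "w j \<noteq> w 0" using E[OF that] by auto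
    ultimately show ?thesis using a b by (auto simp: w)
  qed
  \<comment> \<open>Shifting by \<open>n - d\<close> carries the edge [w 0, w d] to [w (- d), w 0],
    so the connection set is closed under negation.\<close>
  have neg: "n - d = a \<or> n - d = b" if "{w 0, w d} \<in> E" "d < n" "d \<noteq> 0" for d
  proof -
    have "{w (0 + (n - d)), w (d + (n - d))} \<in> E" by (rule shift[OF that(1)])
    moreover have "w (d + (n - d)) = w 0" using that by (simp add: w)
    ultimately have "{w 0, w (n - d)} \<in> E" by (simp add: insert_commute)
    from nbr[OF this] show ?thesis using that by simp
  qed
  have Ea: "{w 0, w a} \<in> E" and Eb: "{w 0, w b} \<in> E" using a b e12_in by simp_all
  have b_eq: "b = n - a"
    using neg[OF Ea] neg[OF Eb] a b ab by auto
  have "E = {{w i, w (i + a)} | i. i < n}"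
  proof (intro set_eqI iffI)
    fix e assume e: "e \<in> E"
    obtain i' j' where ij': "e = {w i', w j'}" using E[OF e] by (auto simp: card_2_iff)
    define i j where "i = i' mod n" and "j = j' mod n"
    have ij: "i < n" "j < n" "e = {w i, w j}" using ij' n by (auto simp: i_def j_def wm)
    \<comment> \<open>The edge is rotated until its end \<open>w i\<close> becomes
      \<open>w 0\<close>, where the neighbours are known.\<close>
    have "{w (i + (n - i)), w (j + (n - i))} \<in> E" by (rule shift) (use e ij in simp)
    moreover have "w (i + (n - i)) = w 0" using ij by (simp add: w)
    ultimately have "{w 0, w (n - i + j)} \<in> E" by (simp add: add.commute)
    from nbr[OF this] show "e \<in> {{w i, w (i + a)} | i. i < n}"
    proof
      assume "(n - i + j) mod n = a"
      then have "w j = w (i + a)"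
        using mod_shift_eq_iff[of i n j a] ij a by (simp add: w)
      then show ?thesis using ij by auto
    next
      \<comment> \<open>As \<open>b\<close> is the negative of \<open>a\<close>, here
        \<open>j\<close> precedes \<open>i\<close> by \<open>a\<close>, and the edge is listed from
        its end \<open>w j\<close>.\<close>
      assume "(n - i + j) mod n = b"
      then have "j mod n = (i + b) mod n"
        using mod_shift_eq_iff[of i n j b] ij b by simp
      then have "(j + a) mod n = (i + b + a) mod n" by (metis mod_add_left_eq)
      then have "w i = w (j + a)" using b_eq a by (simp add: w)
      then show ?thesis using ij by (auto simp: insert_commute)
    qed
  next
    fix e assume "e \<in> {{w i, w (i + a)} | i. i < n}"
    then show "e \<in> E" using shift[OF Ea] by (auto simp: add.commute)
  qed
  then show ?thesis by blast
qed

text \<open>Since \<open>n \<ge> 2\<close>, a cycle of length \<open>n\<close> moves every point of its support, so the support is all of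
  \<open>U\<close>.\<close>

lemma cycle_permutation_orbit:
  assumes "cycle_permutation n (perm_restrict g U)" "n \<ge> 2" "finite U" "card U = n"
  shows "\<exists>w. range w = U \<and> (\<forall>i j. w i = w j \<longleftrightarrow> i mod n = j mod n) \<and> (\<forall>i. g (w i) = w (Suc i))"
proof -
  obtain cs where cs: "distinct cs" "length cs = n" "perm_restrict g U = cycle_of_list cs"
    using assms(1) unfolding cycle_permutation_def by blast
  define w where "w i = cs ! (i mod n)" for i
  have rot: "cycle_of_list cs (w i) = w (Suc i)" for i
  proof -
    have "map (cycle_of_list cs) cs = rotate1 cs"
      using cyclic_rotation[of cs 1] cs(1) by simp
    then have "cycle_of_list cs (cs ! (i mod n)) = rotate1 cs ! (i mod n)"
      by (metis assms(2) cs(2) mod_less_divisor nth_map pos2 order_less_le_trans)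
    then show ?thesis using cs(2) assms(2) by (simp add: w_def nth_rotate1 mod_Suc_eq)
  qed
  have w: "w i = w j \<longleftrightarrow> i mod n = j mod n" for i j
    using cs assms(2) by (simp add: w_def nth_eq_iff_index_eq)
  have "i mod n \<noteq> Suc i mod n" for i
    using assms(2) by (auto simp: mod_Suc)
  then have "perm_restrict g U (w i) \<noteq> w i" for i
    using rot w cs(3) by metis
  \<comment> \<open>\<open>perm_restrict g U\<close> fixes every point outside \<open>U\<close>, so
    a point that it moves lies in \<open>U\<close>.\<close>
  then have wU: "w i \<in> U" for i unfolding perm_restrict_def by metis
  have "w ` {..<n} = U"
  proof (rule card_subset_eq)
    show "card (w ` {..<n}) = card U"
      using assms(4) by (subst card_image) (auto simp: inj_on_def w)
  qed (use assms wU in auto)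
  then have "range w = U" using wU by auto
  moreover have "g (w i) = w (Suc i)" for i
    using rot[of i] wU[of i] cs(3) by (metis perm_restrict_def)
  ultimately show ?thesis using w by blast
qed

lemma isomorphic_GP_I:
  fixes p q :: "nat \<Rightarrow> 'a"
  assumes p: "bij_betw p {..<n} A" and q: "bij_betw q {..<n} B" and AB: "A \<inter> B = {}"
    and V: "verts X = A \<union> B"
    and E: "edges X = {{p i, p ((i + 1) mod n)} | i. i < n} \<union> {{p i, q i} | i. i < n}
      \<union> {{q i, q ((i + k) mod n)} | i. i < n}"
  shows "isomorphic X (GP n k)"
proof -
  \<comment> \<open>Case distinction on the datatype defines a map out of \<open>GP n k\<close>;
    symmetry of isomorphism then reverses the direction.\<close>
  define f where "f x = (case x of gp_vertex.u i \<Rightarrow> p i | gp_vertex.v i \<Rightarrow> q i)" for x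
  have "bij_betw f (verts (GP n k)) (verts X)"
    using p q AB unfolding bij_betw_def V GP_def f_def
    by (force simp: inj_on_def image_Un image_image)
  moreover have "(\<lambda>e. f ` e) ` edges (GP n k) = edges X"
    unfolding GP_def E f_def
    by (simp add: image_Un setcompr_eq_image image_image)
  ultimately have "isomorphic (GP n k) X"
    unfolding isomorphic_def by blast
  then show ?thesis
    by (rule isomorphic_sym) (auto simp: GP_def)
qed

text \<open>The unique edge of \<open>M\<close> at \<open>x\<close> has exactly one other end. This
  lets the 1-factor be treated as a function on vertices.\<close>

lemma perfect_matching_partner:
  assumes "simple_graph X" "k_factor X 1 M" "x \<in> verts X"
  shows "\<exists>!y. {x, y} \<in> M"
proof -
  have M: "M \<subseteq> edges X" "card {e \<in> M. x \<in> e} = 1"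
    using assms(2,3) unfolding k_factor_def by auto
  obtain e where e: "{e \<in> M. x \<in> e} = {e}"
    using M(2) by (auto simp: card_1_singleton_iff)
  then have "card e = 2" "x \<in> e" using M(1) assms(1) unfolding simple_graph_def by auto
  then obtain y where "e = {x, y}" by (auto simp: card_2_iff)
  moreover have "{x, z} \<in> M \<longleftrightarrow> {x, z} \<in> {e \<in> M. x \<in> e}" for z by simp
  ultimately have "{x, z} \<in> M \<longleftrightarrow> z = y" for z
    unfolding e by (auto simp: doubleton_eq_iff)
  then show ?thesis by simp
qed

lemma Aut_funpow:
  assumes "g \<in> Aut X"
  shows "g ^^ k \<in> Aut X"
proof (induction k)
  case 0
  then show ?case by (simp add: Aut_def permutes_def)
next
  case (Suc k)
  have "(\<lambda>e. (g \<circ> (g ^^ k)) ` e) ` edges X = (\<lambda>e. g ` e) ` (\<lambda>e. (g ^^ k) ` e) ` edges X"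
    by (simp add: image_image image_comp)
  moreover have "g \<circ> (g ^^ k) permutes verts X"
    using Suc assms by (auto simp: Aut_def intro: permutes_compose)
  ultimately show ?case using Suc assms by (simp add: Aut_def del: o_apply)
qed

text \<open>A path starting at \<open>x\<close> cannot leave \<open>S\<close>. This will rule out
  that every edge meeting \<open>U\<close> stays inside \<open>U\<close>.\<close>

lemma connected_graph_no_closed_subset:
  assumes "connected_graph X" "x \<in> S" "x \<in> verts X"
    and closed: "\<And>y z. {y, z} \<in> edges X \<Longrightarrow> y \<in> S \<Longrightarrow> z \<in> S"
  shows "verts X \<subseteq> S"
proof
  fix y assume "y \<in> verts X"
  then have "(x, y) \<in> {(a, b). {a, b} \<in> edges X}\<^sup>*"
    using assms unfolding connected_graph_def by blast
  then show "y \<in> S"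
    by (induction rule: rtrancl_induct) (use assms(2) closed in auto)
qed

theorem theorem3p2:
  fixes X C1 C2 :: "'a ugraph" and n :: nat and M F :: "'a set set"
    and U :: "'a set" and H :: "('a \<Rightarrow> 'a) set"
  assumes "simple_graph X"
    and "connected_graph X"
    and "trivalent X"
    and "vertex_transitive X"
    and "card (verts X) = 2 * n"
    and "Aut_invariant_partition X {M, F}"
    and "k_factor X 1 M"
    and "k_factor X 2 F"
    and "cycle_graph n C1"
    and "cycle_graph n C2"
    and "verts C1 \<inter> verts C2 = {}"
    and "verts C1 \<union> verts C2 = verts X"
    and "F = edges C1 \<union> edges C2"
    and "U = verts C1"
    and "H = (\<lambda>g. perm_restrict g U) ` setwise_stabilizer X U"
    and "\<exists>h\<in>H. cycle_permutation n h"
  shows "\<exists>k. isomorphic X (GP n k)"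
proof -

  \<comment> \<open>The stabilizer of \<open>U\<close> acting on the two cycles\<close>
  define W where "W = verts C2"
  have UW: "U \<inter> W = {}" "U \<union> W = verts X" using assms W_def by auto
  have n: "n \<ge> 3" using assms(9) unfolding cycle_graph_def by simp
  have U: "card U = n" "finite U" and W: "card W = n" "finite W"
    using assms W_def cycle_graph_card by auto
  have sub1: "e \<subseteq> U" "card e = 2" if "e \<in> edges C1" for e
    using cycle_graph_edges_subset assms(9,14) that by auto
  have sub2: "e \<subseteq> W" "card e = 2" if "e \<in> edges C2" for e
    using cycle_graph_edges_subset assms(10) that W_def by auto
  have edgesX: "edges X = M \<union> F"
    using assms(6) unfolding Aut_invariant_partition_def partition_on_def by auto
  have inv: "g ` e \<in> M" if "g \<in> Aut X" "e \<in> M" for g e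
    using assms(6) that unfolding Aut_invariant_partition_def by blast
  have invF: "g ` e \<in> F" if "g \<in> Aut X" "e \<in> F" for g e
    using assms(6) that unfolding Aut_invariant_partition_def by blast
  have AutV: "g x \<in> verts X \<longleftrightarrow> x \<in> verts X" "inj g" if "g \<in> Aut X" for g x
    using that unfolding Aut_def by (auto simp: permutes_in_image permutes_inj)
  \<comment> \<open>An automorphism preserves \<open>F\<close> but might exchange the cycles; one
    fixing \<open>U\<close> setwise cannot, since a nonempty set inside \<open>U\<close> is not an
    edge of \<open>C2\<close>.\<close>
  have inv1: "g ` e \<in> edges C1" if "g \<in> Aut X" "g ` U = U" "e \<in> edges C1" for g e
  proof -
    have "g ` e \<in> F" using invF that assms(13) by simp
    moreover have "g ` e \<subseteq> U" using image_mono[OF sub1(1)[OF that(3)]] that(2) by metis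
    moreover have "g ` e \<noteq> {}" using sub1[OF that(3)] by auto
    ultimately show ?thesis using sub2[of "g ` e"] assms(13) UW by blast
  qed
  have gW: "g x \<in> W" if "g \<in> Aut X" "g ` U = U" "x \<in> W" for g x
  proof -
    have "g x \<in> verts X" using AutV that UW by blast
    moreover have "g x \<notin> U"
      using that AutV(2)[OF that(1)] UW(1) inj_image_mem_iff[of g x U] by auto
    ultimately show ?thesis using UW by blast
  qed
  have inv2: "g ` e \<in> edges C2" if "g \<in> Aut X" "g ` U = U" "e \<in> edges C2" for g e
  proof -
    have "g ` e \<in> F" using invF that assms(13) by simp
    moreover have "g ` e \<subseteq> W" using sub2(1)[OF that(3)] gW[OF that(1,2)] by blast
    moreover have "g ` e \<noteq> {}" using sub2[OF that(3)] by auto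
    ultimately show ?thesis using sub1[of "g ` e"] assms(13) UW by blast
  qed
  have degF: "card {e \<in> F. x \<in> e} = 2" if "x \<in> verts X" for x
    using assms(8) that unfolding k_factor_def by blast
  have deg1: "card {e \<in> edges C1. x \<in> e} = 2" if "x \<in> U" for x
  proof -
    have "{e \<in> edges C1. x \<in> e} = {e \<in> F. x \<in> e}" using that sub2 UW assms(13) by blast
    then show ?thesis using degF[of x] that UW by auto
  qed
  have deg2: "card {e \<in> edges C2. x \<in> e} = 2" if "x \<in> W" for x
  proof -
    have "{e \<in> edges C2. x \<in> e} = {e \<in> F. x \<in> e}" using that sub1 UW assms(13) by blast
    then show ?thesis using degF[of x] that UW by auto
  qed

  \<comment> \<open>Labelling \<open>C1\<close> by consecutive vertices\<close>
  obtain g where g: "g \<in> Aut X" "g ` U = U" "cycle_permutation n (perm_restrict g U)"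
    using assms(15,16) unfolding setwise_stabilizer_def by blast
  obtain w where w: "range w = U" "\<And>i j. w i = w j \<longleftrightarrow> i mod n = j mod n"
    "\<And>i. g (w i) = w (Suc i)"
    using cycle_permutation_orbit[OF g(3)] n U by auto
  have wU: "w i \<in> U" for i using w(1) by blast
  have "\<exists>a. edges C1 = {{w i, w (i + a)} | i. i < n}"
  proof (rule orbit_edges_circulant[where \<sigma> = g])
    show "e \<subseteq> range w \<and> card e = 2" if "e \<in> edges C1" for e
      using sub1[OF that] w(1) by simp
  qed (use n w(2,3) inv1[OF g(1,2)] deg1[OF wU] in auto)
  then obtain a where a: "edges C1 = {{w i, w (i + a)} | i. i < n}" by blast

  define \<rho> where "\<rho> = g ^^ a"
  have \<rho>w: "\<rho> (w i) = w (i + a)" for i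
    unfolding \<rho>_def by (induction a) (auto simp: w(3))
  have \<rho>: "\<rho> \<in> Aut X" unfolding \<rho>_def by (rule Aut_funpow[OF g(1)])
  have "(g ^^ m) ` U = U" for m
    by (induction m) (simp_all only: funpow.simps image_comp[symmetric] image_id image_ident id_apply g(2))
  then have \<rho>U: "\<rho> ` U = U" unfolding \<rho>_def by blast
  \<comment> \<open>This is the \<open>i\<close>-th power of \<open>\<rho>\<close> applied to
    \<open>w 0\<close>. That the multiples of \<open>a\<close> run through all residues modulo
    \<open>n\<close> will follow from the connectedness of \<open>C1\<close>.\<close>
  define p where "p i = w (i * a)" for i
  have \<rho>p: "\<rho> (p i) = p (Suc i)" for i
    by (simp add: p_def \<rho>w add.commute)
  have p_mod: "p (i mod n) = p i" for i
    by (simp add: p_def w(2) mod_mult_left_eq)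
  have pU: "p i \<in> U" for i by (simp add: p_def wU)
  have edge1: "\<exists>x. x \<in> U \<and> e = {x, \<rho> x}" if "e \<in> edges C1" for e
  proof -
    obtain i where "e = {w i, w (i + a)}" using \<open>e \<in> edges C1\<close> unfolding a by blast
    then show ?thesis using wU[of i] \<rho>w[of i] by (intro exI[of _ "w i"]) simp
  qed
  have "U \<subseteq> range p"
    unfolding assms(14)
  proof (rule cycle_graph_closed_subset[OF assms(9)])
    show "p 0 \<in> verts C1" using pU assms(14) by simp
    fix y z assume yz: "{y, z} \<in> edges C1" and y: "y \<in> range p"
    obtain x where "{y, z} = {x, \<rho> x}" using edge1[OF yz] by blast
    then consider "z = \<rho> y" | "y = \<rho> z" by (auto simp: doubleton_eq_iff)
    then show "z \<in> range p"
    proof cases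
      case 1
      then show ?thesis using y \<rho>p by auto
    next
      case 2
      obtain j where j: "y = p j" using y by blast
      \<comment> \<open>The predecessor of \<open>p j\<close> is reached by going forward
        \<open>n - 1\<close> steps, which also covers \<open>j = 0\<close>.\<close>
      have "p j = p (j + n)" using p_mod[of "j + n"] p_mod[of j] by simp
      also have "\<dots> = \<rho> (p (j + n - 1))" using n by (simp add: \<rho>p)
      finally have "z = p (j + n - 1)" using 2 j AutV(2)[OF \<rho>] by (auto dest: injD)
      then show ?thesis by blast
    qed
  qed simp
  then have p_range: "p ` {..<n} = U"
  proof -
    have "range p \<subseteq> p ` {..<n}"
      using p_mod n by (metis image_eqI image_subsetI lessThan_iff mod_less_divisor
          order_less_le_trans zero_less_numeral)
    then show ?thesis using \<open>U \<subseteq> range p\<close> pU by auto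
  qed
  \<comment> \<open>A map from \<open>n\<close> indices onto the \<open>n\<close> vertices of
    \<open>U\<close> is injective.\<close>
  have p_bij: "bij_betw p {..<n} U"
    using p_range U by (auto simp: bij_betw_def intro: eq_card_imp_inj_on)
  have p_eq: "p i = p j \<longleftrightarrow> i mod n = j mod n" for i j
    using p_bij n p_mod[of i] p_mod[of j] inj_on_eq_iff[of p "{..<n}" "i mod n" "j mod n"]
    by (simp add: bij_betw_def)
  have E1: "edges C1 = {{p i, p ((i + 1) mod n)} | i. i < n}"
  proof (intro set_eqI iffI)
    fix e assume "e \<in> edges C1"
    then obtain x where x: "x \<in> U" "e = {x, \<rho> x}" using edge1 by blast
    then obtain i where "i < n" "x = p i" using p_range by blast
    then show "e \<in> {{p i, p ((i + 1) mod n)} | i. i < n}"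
      using x \<rho>p p_mod by auto
  next
    fix e assume "e \<in> {{p i, p ((i + 1) mod n)} | i. i < n}"
    then obtain i where e: "e = {w (i * a), w (i * a + a)}"
      using p_mod by (auto simp: p_def add.commute)
    \<comment> \<open>The description of \<open>C1\<close> in terms of \<open>w\<close> uses base
      indices below \<open>n\<close>, so \<open>i * a\<close> has to be reduced modulo
      \<open>n\<close>.\<close>
    have "{w j, w (j + a)} = {w (j mod n), w (j mod n + a)}" for j
      by (simp add: doubleton_eq_iff w(2) mod_add_left_eq)
    then show "e \<in> edges C1"
      unfolding e a using n by (intro CollectI exI[of _ "(i * a) mod n"]) auto
  qed

  \<comment> \<open>The 1-factor and the labelling of \<open>C2\<close>\<close>
  define mate where "mate x = (THE y. {x, y} \<in> M)" for x
  have mate: "{x, y} \<in> M \<longleftrightarrow> y = mate x" if "x \<in> verts X" for x y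
    unfolding mate_def using theI'[OF perfect_matching_partner[OF assms(1,7) that]]
      perfect_matching_partner[OF assms(1,7) that] by blast
  have M_sub: "e \<subseteq> verts X" "card e = 2" if "e \<in> M" for e
    using that edgesX assms(1) unfolding simple_graph_def by auto
  have mateV: "mate x \<in> verts X" "mate (mate x) = x" if "x \<in> verts X" for x
  proof -
    have *: "{x, mate x} \<in> M" using mate[OF that] by blast
    then show V: "mate x \<in> verts X" using M_sub by blast
    show "mate (mate x) = x" using mate[OF V, of x] * by (simp add: insert_commute)
  qed
  have \<rho>mate: "\<rho> (mate x) = mate (\<rho> x)" if "x \<in> verts X" for x
  proof -
    have "\<rho> ` {x, mate x} \<in> M" using mate[OF that] inv[OF \<rho>] by blast
    then show ?thesis using mate[of "\<rho> x"] AutV(1)[OF \<rho>] that by simp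
  qed
  define q where "q i = mate (p i)" for i
  have pV: "p i \<in> verts X" for i using pU UW by blast
  have \<rho>q: "\<rho> (q i) = q (Suc i)" for i
    unfolding q_def using \<rho>mate[OF pV] \<rho>p by simp
  have q_eq: "q i = q j \<longleftrightarrow> i mod n = j mod n" for i j
    unfolding q_def using mateV(2)[OF pV] p_eq by metis
  \<comment> \<open>If the matching edge at \<open>p 0\<close> stayed inside \<open>U\<close>, so
    would its images under the powers of \<open>\<rho>\<close>, which are the matching edges at all
    vertices of \<open>U\<close>. Then no edge would leave \<open>U\<close>, although
    \<open>W\<close> is nonempty and \<open>X\<close> is connected.\<close>
  have q0: "q 0 \<in> W"
  proof (rule ccontr)
    assume "q 0 \<notin> W"
    then have "q 0 \<in> U" using mateV(1)[OF pV] UW unfolding q_def by blast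
    then have qU: "q i \<in> U" for i
    proof (induction i)
      case (Suc i)
      then show ?case using \<rho>q \<rho>U by (metis imageI)
    qed
    have "verts X \<subseteq> U"
    proof (rule connected_graph_no_closed_subset[OF assms(2) pU pV])
      fix y z assume yz: "{y, z} \<in> edges X" and y: "y \<in> U"
      consider "{y, z} \<in> M" | "{y, z} \<in> edges C1" | "{y, z} \<in> edges C2"
        using yz edgesX assms(13) by blast
      then show "z \<in> U"
      proof cases
        case 1
        obtain i where "y = p i" using y p_range by blast
        then show ?thesis using 1 mate[OF pV] qU q_def by metis
      next
        case 2
        then show ?thesis using sub1 by blast
      next
        case 3
        then show ?thesis using sub2 y UW by blast
      qed
    qed
    then have "W = {}" using UW by blast
    then show False using W n by simp
  qed
  have qW: "q i \<in> W" for i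
    by (induction i) (use q0 gW[OF \<rho> \<rho>U] \<rho>q in \<open>metis+\<close>)
  have q_inj: "inj_on q {..<n}" by (auto simp: inj_on_def q_eq)
  have q_range: "q ` {..<n} = W"
    by (rule card_subset_eq) (use W qW q_inj in \<open>auto simp: card_image\<close>)
  have q_bij: "bij_betw q {..<n} W" using q_inj q_range by (simp add: bij_betw_def)
  \<comment> \<open>The shift used on \<open>C2\<close> is \<open>\<rho>\<close>, not
    \<open>g\<close>: the same indices then number the outer cycle, the spokes and the inner
    cycle.\<close>
  have "\<exists>k. edges C2 = {{q i, q (i + k)} | i. i < n}"
  proof (rule orbit_edges_circulant[where \<sigma> = \<rho>])
    show "e \<subseteq> range q \<and> card e = 2" if "e \<in> edges C2" for e
      using sub2[OF that] q_range by blast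
  qed (use n q_eq \<rho>q inv2[OF \<rho> \<rho>U] deg2[OF qW] in auto)
  then obtain k where k: "edges C2 = {{q i, q (i + k)} | i. i < n}" by blast
  have "q (i mod n) = q i" for i by (simp add: q_eq)
  then have E2: "edges C2 = {{q i, q ((i + k) mod n)} | i. i < n}"
    using k by simp
  have EM: "M = {{p i, q i} | i. i < n}"
  proof (intro set_eqI iffI)
    fix e assume e: "e \<in> M"
    obtain x y where xy: "e = {x, y}" using M_sub[OF e] by (auto simp: card_2_iff)
    have x: "x \<in> verts X" using xy M_sub[OF e] by auto
    have y: "y = mate x" using mate[OF x] e xy by blast
    show "e \<in> {{p i, q i} | i. i < n}"
    \<comment> \<open>If \<open>x\<close> is in \<open>W\<close> it is some \<open>q i\<close>, and
      since \<open>mate\<close> is an involution the other end is \<open>p i\<close>.\<close>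
    proof (cases "x \<in> U")
      case True
      then obtain i where "i < n" "x = p i" using p_range by blast
      then show ?thesis using xy y q_def by auto
    next
      case False
      then obtain i where i: "i < n" "x = q i" using x UW q_range by blast
      then have "y = p i" using y mateV(2)[OF pV] q_def by simp
      then show ?thesis using i xy by (auto simp: insert_commute)
    qed
  next
    fix e assume "e \<in> {{p i, q i} | i. i < n}"
    then show "e \<in> M" using mate[OF pV] q_def by auto
  qed
  have "isomorphic X (GP n k)"
    by (rule isomorphic_GP_I[OF p_bij q_bij UW(1) UW(2)[symmetric]])
      (simp only: edgesX assms(13) E1 E2 EM Un_ac)
  then show ?thesis by blast
qed

end
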